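(* Let $n \geq 2$ and $N = \{1,2,\ldots,n\}$. For any additive measure $\nu$ on $N$ with $\nu(\{i\}) \neq 0$ for all $i \in N$, there exists a strictly supermodular measure $\mu$ on $N$ such that $\nu(A) \geq \mu(A)$ for all $A \subseteq N$.
   Context: Let $\mathcal{P}(N)$ denote the power set of $N$. An additive measure on $N$ is a set function $\nu : \mathcal{P}(N) \to [0,1]$ such that $\nu(\emptyset) = 0$, $\nu(N) = 1$, and $\nu(A \cup B) = \nu(A) + \nu(B)$ for all $A, B \subseteq N$ with $A \cap B = \emptyset$. A fuzzy measure on $N$ is a set function $\mu : \mathcal{P}(N) \to [0,1]$ such that $\mu(\emptyset) = 0$, $\mu(N) = 1$, and $A \subseteq B \subseteq N$ implies $\mu(A) \leq \mu(B)$. A strictly supermodular measure on $N$ is a fuzzy measure $\mu$ on $N$ such that $\mu(A \cup B) + \mu(A \cap B) > \mu(A) + \mu(B)$ for all $A, B \subseteq N$ with $A \cap B \neq A$ and $A \cap B \neq B$. *)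

theory Defs
  imports Complex_Main
begin

(* A set function on the power set of N is a total function on sets of which only
   the values at subsets of N matter; its values elsewhere are unconstrained. *)

definition additive_measure_on :: "'a set \<Rightarrow> ('a set \<Rightarrow> real) \<Rightarrow> bool" where
  "additive_measure_on N \<nu> \<longleftrightarrow>
     (\<forall>A. A \<subseteq> N \<longrightarrow> \<nu> A \<in> {0..1}) \<and>
     \<nu> {} = 0 \<and> \<nu> N = 1 \<and>
     (\<forall>A B. A \<subseteq> N \<and> B \<subseteq> N \<and> A \<inter> B = {} \<longrightarrow> \<nu> (A \<union> B) = \<nu> A + \<nu> B)"

definition fuzzy_measure_on :: "'a set \<Rightarrow> ('a set \<Rightarrow> real) \<Rightarrow> bool" where
  "fuzzy_measure_on N \<mu> \<longleftrightarrow>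
     (\<forall>A. A \<subseteq> N \<longrightarrow> \<mu> A \<in> {0..1}) \<and>
     \<mu> {} = 0 \<and> \<mu> N = 1 \<and>
     (\<forall>A B. A \<subseteq> B \<and> B \<subseteq> N \<longrightarrow> \<mu> A \<le> \<mu> B)"

definition strictly_supermodular_measure_on :: "'a set \<Rightarrow> ('a set \<Rightarrow> real) \<Rightarrow> bool" where
  "strictly_supermodular_measure_on N \<mu> \<longleftrightarrow>
     fuzzy_measure_on N \<mu> \<and>
     (\<forall>A B. A \<subseteq> N \<and> B \<subseteq> N \<and> A \<inter> B \<noteq> A \<and> A \<inter> B \<noteq> B \<longrightarrow>
        \<mu> (A \<union> B) + \<mu> (A \<inter> B) > \<mu> A + \<mu> B)"

end

(* The witness is the square of \<nu>: if a, b, c are the values of \<nu> on A - B, B - A and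
   A \<inter> B, then (a + b + c)^2 + c^2 - (a + c)^2 - (b + c)^2 = 2 a b, which is positive
   because \<nu> charges every point; and x^2 \<le> x on [0,1]. *)

theory Submission
  imports Defs
begin

text \<open>Splitting one point \<open>i\<close> off \<open>A\<close> leaves a remainder of
  nonnegative measure, and \<nu> {i}, being nonnegative and nonzero, is positive. This is the source
  of strictness in the supermodular inequality.\<close>

lemma additive_measure_on_pos:
  assumes \<nu>: "additive_measure_on N \<nu>" and nz: "\<forall>i\<in>N. \<nu> {i} \<noteq> 0"
    and "A \<subseteq> N" "A \<noteq> {}"
  shows "\<nu> A > 0"
proof -
  obtain i where i: "i \<in> A" using \<open>A \<noteq> {}\<close> by blast
  then have sub: "{i} \<subseteq> N" "A - {i} \<subseteq> N" and eq: "{i} \<union> (A - {i}) = A"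
    using \<open>A \<subseteq> N\<close> by auto
  have "\<nu> ({i} \<union> (A - {i})) = \<nu> {i} + \<nu> (A - {i})"
    using \<nu> sub unfolding additive_measure_on_def by blast
  moreover have "\<nu> {i} \<ge> 0" "\<nu> (A - {i}) \<ge> 0"
    using \<nu> sub unfolding additive_measure_on_def by auto
  moreover have "\<nu> {i} \<noteq> 0" using nz sub by blast
  ultimately show ?thesis unfolding eq by linarith
qed

lemma additive_measure_on_mono:
  assumes \<nu>: "additive_measure_on N \<nu>" and "A \<subseteq> B" "B \<subseteq> N"
  shows "\<nu> A \<le> \<nu> B"
proof -
  have sub: "A \<subseteq> N" "B - A \<subseteq> N" and eq: "A \<union> (B - A) = B"
    using assms(2,3) by auto
  have "\<nu> (A \<union> (B - A)) = \<nu> A + \<nu> (B - A)"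
    using \<nu> sub unfolding additive_measure_on_def by blast
  moreover have "\<nu> (B - A) \<ge> 0"
    using \<nu> sub unfolding additive_measure_on_def by auto
  ultimately show ?thesis unfolding eq by linarith
qed

lemma strictly_supermodular_measure_on_square:
  assumes \<nu>: "additive_measure_on N \<nu>" and nz: "\<forall>i\<in>N. \<nu> {i} \<noteq> 0"
  shows "strictly_supermodular_measure_on N (\<lambda>A. (\<nu> A)\<^sup>2)"
  unfolding strictly_supermodular_measure_on_def fuzzy_measure_on_def
proof (intro conjI allI impI)
  have range: "0 \<le> \<nu> A" "\<nu> A \<le> 1" if "A \<subseteq> N" for A
    using \<nu> that unfolding additive_measure_on_def by auto
  show "(\<nu> A)\<^sup>2 \<in> {0..1}" if "A \<subseteq> N" for A
    using range[OF that] by (simp add: power_le_one)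
  show "(\<nu> {})\<^sup>2 = 0" "(\<nu> N)\<^sup>2 = 1"
    using \<nu> unfolding additive_measure_on_def by auto
  \<comment> \<open>Squaring preserves order only on nonnegative reals, so monotonicity of \<nu> is
    combined with the lower bound \<open>range(1)\<close>.\<close>
  show "(\<nu> A)\<^sup>2 \<le> (\<nu> B)\<^sup>2" if "A \<subseteq> B \<and> B \<subseteq> N" for A B
    using additive_measure_on_mono[OF \<nu>, of A B] range(1)[of A] that by (intro power_mono) auto
  show "(\<nu> A)\<^sup>2 + (\<nu> B)\<^sup>2 < (\<nu> (A \<union> B))\<^sup>2 + (\<nu> (A \<inter> B))\<^sup>2"
    if AB: "A \<subseteq> N \<and> B \<subseteq> N \<and> A \<inter> B \<noteq> A \<and> A \<inter> B \<noteq> B" for A B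
  proof -
    let ?a = "\<nu> (A - B)" and ?b = "\<nu> (B - A)" and ?c = "\<nu> (A \<inter> B)"
    have add: "\<nu> (X \<union> Y) = \<nu> X + \<nu> Y" if "X \<subseteq> N" "Y \<subseteq> N" "X \<inter> Y = {}" for X Y
      using \<nu> that unfolding additive_measure_on_def by blast
    \<comment> \<open>The three disjoint pieces make up \<open>A\<close>, \<open>B\<close> and their
      union, so all four values in the inequality become sums of \<open>?a\<close>,
      \<open>?b\<close>, \<open>?c\<close>. The unions stay unsimplified here so that
      \<open>add\<close> matches them.\<close>
    have "\<nu> ((A - B) \<union> (A \<inter> B)) = ?a + ?c" "\<nu> ((B - A) \<union> (A \<inter> B)) = ?b + ?c"
      "\<nu> (A \<union> (B - A)) = \<nu> A + ?b"
      by (rule add; use AB in blast)+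
    moreover have "(A - B) \<union> (A \<inter> B) = A" "(B - A) \<union> (A \<inter> B) = B" "A \<union> (B - A) = A \<union> B"
      by auto
    ultimately have eqs: "\<nu> A = ?a + ?c" "\<nu> B = ?b + ?c" "\<nu> (A \<union> B) = ?a + ?c + ?b"
      by simp_all
    \<comment> \<open>The two inequations in \<open>AB\<close> say that neither set contains the
      other, so both differences are nonempty.\<close>
    have "?a > 0" "?b > 0"
      using AB by (auto intro!: additive_measure_on_pos[OF \<nu> nz])
    then have "?a * ?b > 0" by simp
    then show ?thesis
      \<comment> \<open>All squares and the other mixed products cancel, leaving the positivity of
        \<open>?a * ?b\<close>.\<close>
      unfolding eqs by (simp add: power2_eq_square algebra_simps)
  qed
qed

theorem corollary1:
  fixes n :: nat and N :: "nat set" and \<nu> :: "nat set \<Rightarrow> real"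
  assumes "n \<ge> 2"
    and "N = {1..n}"
    and "additive_measure_on N \<nu>"
    and "\<forall>i\<in>N. \<nu> {i} \<noteq> 0"
  shows "\<exists>\<mu>. strictly_supermodular_measure_on N \<mu> \<and> (\<forall>A. A \<subseteq> N \<longrightarrow> \<nu> A \<ge> \<mu> A)"
proof (intro exI conjI allI impI)
  \<comment> \<open>Proving this conjunct instantiates the schematic witness left by
    \<open>exI\<close>.\<close>
  show "strictly_supermodular_measure_on N (\<lambda>A. (\<nu> A)\<^sup>2)"
    using assms(3,4) by (rule strictly_supermodular_measure_on_square)
  \<comment> \<open>Multiply \<nu> A \<le> 1 by the nonnegative number \<nu> A.\<close>
  show "(\<nu> A)\<^sup>2 \<le> \<nu> A" if "A \<subseteq> N" for A
    using assms(3) that unfolding additive_measure_on_def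
    by (auto simp: power2_eq_square intro: mult_left_le)
qed

end
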